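(* Let $\lambda$ be a nonzero real number, $\gamma$ a complex number, and $Y$ a random variable as in the context. For every integer $n\ge0$, \[ D_{n,\lambda}^{(\gamma,Y)}=\sum_{k=0}^{n}\beta_{k,\lambda}^{(\gamma,Y)}S_{1,\lambda}^{Y}(n,k). \]
   Context: $(x)_{0,\lambda}=1$, $(x)_{n,\lambda}=x(x-\lambda)\cdots(x-(n-1)\lambda)$ for $n\ge1$. $Y$ is a random variable whose moment-generating function $E[e^{tY}]$ exists for $|t|<r$ for some $r>0$, and $E[Y]\neq0$. $E[e_{\lambda}^{Y}(t)]$ denotes the formal power series $\sum_{n\ge0}E[(Y)_{n,\lambda}]\frac{t^n}{n!}$; $e_{Y,\lambda}(t)=E[e_{\lambda}^{Y}(t)]-1$ is a delta series with linear coefficient $E[Y]$, and the probabilistic degenerate logarithm $\log_{\lambda}^{Y}(1+t)$ is its compositional inverse. The probabilistic degenerate Stirling numbers of the first kind: $\frac1{k!}\big(\log_{\lambda}^{Y}(1+t)\big)^k=\sum_{n\ge k}S_{1,\lambda}^{Y}(n,k)\frac{t^n}{n!}$. The probabilistic degenerate Bernoulli numbers of order $\gamma$: $\big(\frac{t}{E[e_{\lambda}^{Y}(t)]-1}\big)^{\gamma}=\sum_{n\ge0}\beta_{n,\lambda}^{(\gamma,Y)}\frac{t^n}{n!}$. The probabilistic degenerate Daehee numbers of order $\gamma$: $\big(\frac{\log_{\lambda}^{Y}(1+t)}{t}\big)^{\gamma}=\sum_{n\ge0}D_{n,\lambda}^{(\gamma,Y)}\frac{t^n}{n!}$. Complex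 powers of series with constant term $E[Y]^{\pm1}$ are taken as $c^{\gamma}(1+u)^{\gamma}=c^\gamma\sum_m\binom{\gamma}{m}u^m$ ($u(0)=0$), using one fixed determination of $E[Y]^{-\gamma}$ for both $(1/E[Y])^{\gamma}$ and $(E[Y])^{-\gamma}$. *)

theory Defs
  imports "HOL-Probability.Probability" "HOL-Computational_Algebra.Formal_Power_Series"
begin

definition degenerate_ffact :: "real \<Rightarrow> real \<Rightarrow> nat \<Rightarrow> real" where
  "degenerate_ffact lam x n = (\<Prod>i<n. x - real i * lam)"

definition degenerate_exp_series :: "'a measure \<Rightarrow> ('a \<Rightarrow> real) \<Rightarrow> real \<Rightarrow> complex fps" where
  "degenerate_exp_series M Y lam =
     Abs_fps (\<lambda>n. complex_of_real ((\<integral>\<omega>. degenerate_ffact lam (Y \<omega>) n \<partial>M) / fact n))"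

definition degenerate_delta :: "'a measure \<Rightarrow> ('a \<Rightarrow> real) \<Rightarrow> real \<Rightarrow> complex fps" where
  "degenerate_delta M Y lam = degenerate_exp_series M Y lam - 1"

text \<open>The series \<open>log\<^sub>\<lambda>\<^sup>Y(1 + t)\<close>, as a power series in \<open>t\<close>.\<close>
definition degenerate_log :: "'a measure \<Rightarrow> ('a \<Rightarrow> real) \<Rightarrow> real \<Rightarrow> complex fps" where
  "degenerate_log M Y lam = fps_inv (degenerate_delta M Y lam)"

definition degenerate_stirling1 ::
    "'a measure \<Rightarrow> ('a \<Rightarrow> real) \<Rightarrow> real \<Rightarrow> nat \<Rightarrow> nat \<Rightarrow> complex" where
  "degenerate_stirling1 M Y lam n k =
     fact n * fps_nth (fps_const (1 / fact k) * degenerate_log M Y lam ^ k) n"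

text \<open>
  Complex power \<open>f\<^sup>\<gamma> = c\<^sup>\<gamma> (1 + u)\<^sup>\<gamma>\<close> of a series \<open>f = c (1 + u)\<close> with \<open>c \<noteq> 0\<close> and \<open>u(0) = 0\<close>.
  The argument \<open>w\<close> is a logarithm of \<open>c\<close> (that is, \<open>exp w = c\<close>); it selects the
  determination \<open>c\<^sup>\<gamma> = exp (\<gamma> w)\<close>.
\<close>
definition fps_cpow :: "complex \<Rightarrow> complex \<Rightarrow> complex fps \<Rightarrow> complex fps" where
  "fps_cpow w \<gamma> f =
     fps_const (exp (\<gamma> * w)) * (fps_binomial \<gamma> oo (f / fps_const (fps_nth f 0) - 1))"

text \<open>
  In the next two definitions \<open>w\<close> is a logarithm of \<open>E[Y]\<close>. Both series raised to the power
  \<open>\<gamma>\<close> have constant term \<open>1 / E[Y]\<close>, of which \<open>- w\<close> is a logarithm, so both use the same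
  value \<open>exp (- \<gamma> w)\<close> of \<open>E[Y]\<^sup>-\<^sup>\<gamma>\<close>.
\<close>
definition degenerate_bernoulli ::
    "'a measure \<Rightarrow> ('a \<Rightarrow> real) \<Rightarrow> real \<Rightarrow> complex \<Rightarrow> complex \<Rightarrow> nat \<Rightarrow> complex" where
  "degenerate_bernoulli M Y lam w \<gamma> n =
     fact n * fps_nth (fps_cpow (- w) \<gamma> (fps_X / degenerate_delta M Y lam)) n"

definition degenerate_daehee ::
    "'a measure \<Rightarrow> ('a \<Rightarrow> real) \<Rightarrow> real \<Rightarrow> complex \<Rightarrow> complex \<Rightarrow> nat \<Rightarrow> complex" where
  "degenerate_daehee M Y lam w \<gamma> n =
     fact n * fps_nth (fps_cpow (- w) \<gamma> (degenerate_log M Y lam / fps_X)) n"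

lemma degenerate_delta_nth_0:
  assumes "prob_space M"
  shows "fps_nth (degenerate_delta M Y lam) 0 = 0"
  using prob_space.prob_space[OF assms]
  by (simp add: degenerate_delta_def degenerate_exp_series_def degenerate_ffact_def)

lemma degenerate_delta_nth_1:
  "fps_nth (degenerate_delta M Y lam) 1 = complex_of_real (\<integral>\<omega>. Y \<omega> \<partial>M)"
  by (simp add: degenerate_delta_def degenerate_exp_series_def degenerate_ffact_def)

lemma degenerate_log_compose:
  assumes "prob_space M" "(\<integral>\<omega>. Y \<omega> \<partial>M) \<noteq> 0"
  shows "degenerate_log M Y lam oo degenerate_delta M Y lam = fps_X"
    and "degenerate_delta M Y lam oo degenerate_log M Y lam = fps_X"
  unfolding degenerate_log_def
  using assms degenerate_delta_nth_0[OF assms(1)] degenerate_delta_nth_1[of M Y lam]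
  by (auto intro!: fps_inv fps_inv_right)

lemma degenerate_quotients_nth_0:
  assumes "prob_space M" "(\<integral>\<omega>. Y \<omega> \<partial>M) \<noteq> 0"
  shows "fps_nth (fps_X / degenerate_delta M Y lam) 0 = 1 / complex_of_real (\<integral>\<omega>. Y \<omega> \<partial>M)"
    and "fps_nth (degenerate_log M Y lam / fps_X) 0 = 1 / complex_of_real (\<integral>\<omega>. Y \<omega> \<partial>M)"
proof -
  let ?e = "degenerate_delta M Y lam"
  have e: "fps_nth ?e 0 = 0" "fps_nth ?e 1 = complex_of_real (\<integral>\<omega>. Y \<omega> \<partial>M)"
    using degenerate_delta_nth_0[OF assms(1)] degenerate_delta_nth_1 by auto
  have sd: "subdegree ?e = 1"
    by (rule subdegreeI) (use e assms in auto)
  have "fps_nth (fps_X / ?e) (subdegree (fps_X :: complex fps) - subdegree ?e)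
      = fps_nth (fps_X :: complex fps) (subdegree (fps_X :: complex fps)) / fps_nth ?e (subdegree ?e)"
    by (subst fps_divide_nth_base) (use sd in \<open>auto simp: divide_inverse\<close>)
  then show "fps_nth (fps_X / ?e) 0 = 1 / complex_of_real (\<integral>\<omega>. Y \<omega> \<partial>M)"
    using e by (simp add: sd)
  show "fps_nth (degenerate_log M Y lam / fps_X) 0 = 1 / complex_of_real (\<integral>\<omega>. Y \<omega> \<partial>M)"
    using e by (simp add: degenerate_log_def fps_inv_def)
qed

lemma fps_cpow_of_nat:
  assumes "exp w = fps_nth f 0"
  shows "fps_cpow w (of_nat n) f = f ^ n"
proof -
  let ?c = "fps_nth f 0" and ?u = "f / fps_const (fps_nth f 0) - 1"
  have c: "?c \<noteq> 0" using assms by (metis exp_not_eq_zero)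
  have u0: "fps_nth ?u 0 = 0" using c by (simp add: fps_divide_unit)
  have "fps_binomial (of_nat n) oo ?u = (1 + fps_X) ^ n oo ?u"
    by (simp add: fps_binomial_of_nat)
  also have "\<dots> = (1 + ?u) ^ n"
    using u0 by (simp only: fps_compose_power [symmetric] fps_compose_add_distrib
        fps_compose_1 fps_X_fps_compose_startby0)
  finally have "fps_cpow w (of_nat n) f = fps_const ?c ^ n * (1 + ?u) ^ n"
    by (simp add: fps_cpow_def exp_of_nat_mult assms fps_const_power)
  also have "\<dots> = (fps_const ?c * (1 + ?u)) ^ n" by (simp add: power_mult_distrib)
  also have "fps_const ?c * (1 + ?u) = f"
    using c by (simp add: fps_divide_unit fps_eq_iff)
  finally show ?thesis .
qed

end

theory Submission
  imports Defs
begin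

text \<open>
  Write \<open>e\<close> for the delta series and \<open>l\<close> for its compositional inverse. Composing
  \<open>(t / e) e = t\<close> with \<open>l\<close> gives \<open>(t / e) \<circ> l = l / t\<close>. Complex powers with a fixed determination
  commute with composition, so the Daehee series is the Bernoulli series composed with \<open>l\<close>;
  comparing coefficients gives the identity.
\<close>

text \<open>Since \<open>g\<close> has zero constant term, \<open>f oo g\<close> and
  \<open>f\<close> have the same constant term, so both powers normalise by the same constant and
  carry the same factor \<open>exp (\<gamma> * w)\<close>.\<close>

lemma fps_cpow_compose:
  assumes "fps_nth f 0 \<noteq> 0" and "fps_nth g 0 = 0"
  shows "fps_cpow w \<gamma> (f oo g) = fps_cpow w \<gamma> f oo g"
proof -
  let ?c = "fps_const (inverse (fps_nth f 0))"
  have div: "h / fps_const (fps_nth f 0) = h * ?c" for h :: "complex fps"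
    using assms(1) by (simp add: fps_divide_unit fps_const_inverse)
  have "(f * ?c - 1) oo g = (f oo g) * ?c - 1"
    using assms(2)
    by (simp only: fps_compose_sub_distrib fps_compose_mult_distrib fps_const_compose fps_compose_1)
  \<comment> \<open>Associativity of composition needs both inner series to vanish at 0.\<close>
  moreover have "fps_nth (f * ?c - 1) 0 = 0"
    using assms(1) by simp
  ultimately have "fps_binomial \<gamma> oo ((f oo g) * ?c - 1) = (fps_binomial \<gamma> oo (f * ?c - 1)) oo g"
    using fps_compose_assoc[OF assms(2)] by metis
  then show ?thesis
    using assms(2)
    by (simp add: fps_cpow_def div fps_compose_mult_distrib mult.commute)
qed

lemma fps_X_divide_compose:
  fixes f g :: "'a::field fps"
  assumes "fps_nth f 0 = 0" and "fps_nth f 1 \<noteq> 0" and "fps_nth g 0 = 0" and "f oo g = fps_X"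
  shows "(fps_X / f) oo g = g / fps_X"
proof -
  have "f \<noteq> 0"
    using assms(2) by auto
  have "subdegree f = 1"
    by (rule subdegreeI) (use assms in auto)
  \<comment> \<open>Both series have subdegree 1, so the division is exact.\<close>
  then have "f dvd fps_X"
    using \<open>f \<noteq> 0\<close> by (simp add: fps_dvd_iff)
  then have "(fps_X / f) * f = fps_X"
    by simp
  then have "((fps_X / f) oo g) * (f oo g) = g"
    using assms(3) by (metis fps_compose_mult_distrib fps_X_fps_compose_startby0)
  then show ?thesis
    by (metis assms(4) fps_X_neq_zero nonzero_mult_div_cancel_right)
qed

theorem theorem4p2:
  fixes M :: "'a measure" and Y :: "'a \<Rightarrow> real" and lam :: real
    and \<gamma> w :: complex and n :: nat
  assumes "prob_space M"
    and "Y \<in> borel_measurable M"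
    and "\<exists>r>0. \<forall>t::real. \<bar>t\<bar> < r \<longrightarrow> integrable M (\<lambda>\<omega>. exp (t * Y \<omega>))"
    and "(\<integral>\<omega>. Y \<omega> \<partial>M) \<noteq> 0"
    and "lam \<noteq> 0"
    and "exp w = complex_of_real (\<integral>\<omega>. Y \<omega> \<partial>M)"
  shows "degenerate_daehee M Y lam w \<gamma> n =
    (\<Sum>k=0..n. degenerate_bernoulli M Y lam w \<gamma> k * degenerate_stirling1 M Y lam n k)"
proof -
  let ?e = "degenerate_delta M Y lam" and ?l = "degenerate_log M Y lam"
  have l0: "fps_nth ?l 0 = 0"
    by (simp add: degenerate_log_def fps_inv_def)
  have "(fps_X / ?e) oo ?l = ?l / fps_X"
    using degenerate_delta_nth_0[OF assms(1)] degenerate_delta_nth_1[of M Y lam] l0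
      degenerate_log_compose(2)[OF assms(1,4)] assms(4)
    by (intro fps_X_divide_compose) auto
  moreover have "fps_nth (fps_X / ?e) 0 \<noteq> 0"
    using degenerate_quotients_nth_0(1)[OF assms(1,4)] assms(4) by simp
  ultimately have "fps_cpow (- w) \<gamma> (?l / fps_X) = fps_cpow (- w) \<gamma> (fps_X / ?e) oo ?l"
    using fps_cpow_compose l0 by metis
  \<comment> \<open>The coefficient of a composition is a sum over powers of \<open>?l\<close>; the
    \<open>fact k\<close> of the Bernoulli number cancels the \<open>1 / fact k\<close> of the
    Stirling number.\<close>
  then show ?thesis
    by (simp add: degenerate_daehee_def degenerate_bernoulli_def degenerate_stirling1_def
        fps_compose_nth sum_distrib_left mult_ac)
qed

end
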